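(* Let $A_1,\dots,A_m$ be streams and let $U=\bigcup_j A_j$ be the set of distinct identifiers occurring in any of them. For each $j$ let $T^{(j)}$ be a threshold choosing function satisfying $1$-Goodness (Condition below), and define the TCF on the union $$T^U(X^{n_U})=\min_{j} T^{(j)}(X^{n_{A_j}}),$$ where $X^{n_U}$ is an assignment of hash values to the distinct identifiers of $U$ and $X^{n_{A_j}}$ is its restriction to the distinct identifiers of $A_j$ (this is the threshold produced by $\mathrm{ThetaUnion}$ applied to the sketches $\mathrm{samp}[T^{(j)}](k,A_j,h)$). Then $T^U$ satisfies $1$-Goodness: for every identifier $\ell\in U$ and every fixed assignment $X^{n_U}_{-\ell}$ of hash values to the identifiers of $U\setminus\{\ell\}$, the function $x_\ell\mapsto T^U(X^{n_U})$ (with $X^{n_U}$ the combination of $X^{n_U}_{-\ell}$ and $x_\ell$) satisfies $1$-Goodness for univariate functions.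
   Context: Identifiers come from a universe $[n]$. A stream $A$ is a finite sequence of identifiers, with $n_A$ distinct identifiers. A hash function $h:[n]\to(0,1)$; $X^{n_A}$ is the assignment of hash values to the distinct identifiers of $A$. A threshold choosing function (TCF) $T$ maps a target size $k$, stream $A$ and $h$ to a threshold $\theta\in(0,1]$ depending on $h$ only through $X^{n_A}$; write $T(X^{n_A})$. The base sampler $\mathrm{samp}[T](k,A,h)$ returns $(\theta,S)$ with $\theta=T(k,A,h)$ and $S$ the set of hash values of identifiers of $A$ that are $<\theta$. $\mathrm{ThetaUnion}$ of sketches $(\theta_j,S_j)$ returns $(\min_j\theta_j,\{x\in\bigcup_j S_j: x<\min_j\theta_j\})$. A function $f:(0,1)\to(0,1]$ satisfies $1$-Goodness if there is a threshold $F$ with: $x<F\Rightarrow f(x)=F$ and $x\ge F\Rightarrow f(x)\le x$. A TCF $T$ satisfies $1$-Goodness if for every stream $A$, every distinct identifier $\ell$ of $A$ and every fixed assignment $X^{n_A}_{-\ell}$ of hash values to the other distinct identifiers of $A$, the fix-all-but-one projection $x_\ell\mapsto T(X^{n_A})$ ($X^{n_A}$ combining $X^{n_A}_{-\ell}$ and $x_\ell$) satisfies $1$-Goodness. When $\ell\notin A_j$, the projection of $T^{(j)}$ with respect to $\ell$ is by convention the constant function $x_\ell\mapsto T^{(j)}(X^{n_{A_j}})$. *)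

theory Defs
  imports Complex_Main "HOL-Library.FuncSet"
begin

definition stream :: "nat \<Rightarrow> nat list \<Rightarrow> bool" where
  "stream n A \<longleftrightarrow> set A \<subseteq> {1..n}"

definition assignments :: "nat set \<Rightarrow> (nat \<Rightarrow> real) set" where
  "assignments I = I \<rightarrow>\<^sub>E {0<..<1}"

abbreviation hash_functions :: "nat \<Rightarrow> (nat \<Rightarrow> real) set" where
  "hash_functions n \<equiv> assignments {1..n}"

type_synonym tcf = "nat \<Rightarrow> nat list \<Rightarrow> (nat \<Rightarrow> real) \<Rightarrow> real"

definition is_tcf :: "nat \<Rightarrow> tcf \<Rightarrow> bool" where
  "is_tcf n T \<longleftrightarrow> (\<forall>k A. stream n A \<longrightarrow>
     (\<forall>h\<in>hash_functions n. T k A h \<in> {0<..1}) \<and>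
     (\<forall>h\<in>hash_functions n. \<forall>h'\<in>hash_functions n.
        restrict h (set A) = restrict h' (set A) \<longrightarrow> T k A h = T k A h'))"

text \<open>The value \<open>T(X)\<close> of a TCF at an assignment \<open>X\<close> of hash values to the identifiers of
  \<open>A\<close>, i.e. the common value of \<open>T k A h\<close> over all hash functions \<open>h\<close> extending \<open>X\<close>.\<close>

definition tcf_at :: "nat \<Rightarrow> tcf \<Rightarrow> nat \<Rightarrow> nat list \<Rightarrow> (nat \<Rightarrow> real) \<Rightarrow> real" where
  "tcf_at n T k A X =
     (THE \<theta>. \<exists>h\<in>hash_functions n. restrict h (set A) = X \<and> T k A h = \<theta>)"

type_synonym sketch = "real \<times> real set"

definition samp :: "tcf \<Rightarrow> nat \<Rightarrow> nat list \<Rightarrow> (nat \<Rightarrow> real) \<Rightarrow> sketch" where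
  "samp T k A h = (T k A h, {x \<in> h ` set A. x < T k A h})"

definition theta_union :: "nat \<Rightarrow> (nat \<Rightarrow> sketch) \<Rightarrow> sketch" where
  "theta_union m sk =
     (let \<theta> = (MIN j\<in>{1..m}. fst (sk j)) in (\<theta>, {x \<in> (\<Union>j\<in>{1..m}. snd (sk j)). x < \<theta>}))"

text \<open>1-Goodness of \<open>f : (0,1) \<rightarrow> (0,1]\<close>. As every threshold, \<open>F\<close> lies in \<open>(0,1]\<close>;
  a nonpositive \<open>F\<close> would make the first implication vacuous.\<close>

definition one_good :: "(real \<Rightarrow> real) \<Rightarrow> bool" where
  "one_good f \<longleftrightarrow> f \<in> {0<..<1} \<rightarrow> {0<..1} \<and>
     (\<exists>F\<in>{0<..1}. \<forall>x\<in>{0<..<1}. (x < F \<longrightarrow> f x = F) \<and> (x \<ge> F \<longrightarrow> f x \<le> x))"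

text \<open>All fix-all-but-one projections of a function \<open>g\<close> of assignments to the identifiers in \<open>I\<close>
  satisfy 1-Goodness.\<close>

definition projections_one_good :: "nat set \<Rightarrow> ((nat \<Rightarrow> real) \<Rightarrow> real) \<Rightarrow> bool" where
  "projections_one_good I g \<longleftrightarrow>
     (\<forall>l\<in>I. \<forall>X\<in>assignments (I - {l}). one_good (\<lambda>x. g (X(l := x))))"

definition tcf_one_good :: "nat \<Rightarrow> nat \<Rightarrow> tcf \<Rightarrow> bool" where
  "tcf_one_good n k T \<longleftrightarrow>
     (\<forall>A. stream n A \<longrightarrow> projections_one_good (set A) (tcf_at n T k A))"

text \<open>Restricting \<open>X\<close> to \<open>set (A j)\<close> makes the \<open>j\<close>-th term independent of the hash value of an
  identifier \<open>l \<notin> set (A j)\<close>, so its projection with respect to \<open>l\<close> is a constant function.\<close>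

definition union_threshold ::
  "nat \<Rightarrow> nat \<Rightarrow> (nat \<Rightarrow> tcf) \<Rightarrow> nat \<Rightarrow> (nat \<Rightarrow> nat list) \<Rightarrow> (nat \<Rightarrow> real) \<Rightarrow> real" where
  "union_threshold n m T k A X =
     (MIN j\<in>{1..m}. tcf_at n (T j) k (A j) (restrict X (set (A j))))"

end

theory Submission
  imports Defs
begin

text \<open>The minimum of 1-good functions with thresholds \<open>F j\<close> is 1-good with threshold
  \<open>F = (MIN j. F j)\<close>: below \<open>F\<close> every component equals its own threshold, and at \<open>x \<ge> F\<close> the
  component attaining the minimum of the \<open>F j\<close> is already at most \<open>x\<close>. A constant function
  with value \<open>c\<close> is 1-good with threshold \<open>c\<close>, which covers the streams that do not contain
  the varied identifier.\<close>

lemma one_good_const: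
  assumes "c \<in> {0<..1}"
  shows "one_good (\<lambda>x. c)"
  using assms unfolding one_good_def by auto

lemma one_good_Min:
  assumes "finite J" "J \<noteq> {}" and good: "\<And>j. j \<in> J \<Longrightarrow> one_good (f j)"
  shows "one_good (\<lambda>x. MIN j\<in>J. f j x)"
proof -
  \<comment> \<open>1-Goodness only asserts that some threshold exists for each \<open>j\<close>;
    choice collects them into one family \<open>F\<close>.\<close>
  have "\<forall>j\<in>J. \<exists>F. F \<in> {0<..1} \<and>
      (\<forall>x\<in>{0<..<1}. (x < F \<longrightarrow> f j x = F) \<and> (x \<ge> F \<longrightarrow> f j x \<le> x))"
    using good unfolding one_good_def by blast
  from bchoice[OF this] obtain F where F: "\<forall>j\<in>J. F j \<in> {0<..1} \<and>
      (\<forall>x\<in>{0<..<1}. (x < F j \<longrightarrow> f j x = F j) \<and> (x \<ge> F j \<longrightarrow> f j x \<le> x))"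
    by (rule exE)
  \<comment> \<open>Kept general in \<open>g\<close> because it serves both the thresholds
    \<open>F\<close> and the values \<open>f j x\<close> at a fixed \<open>x\<close>, whose
    minimizing indices may differ.\<close>
  have attained: "\<exists>i\<in>J. (MIN j\<in>J. g j) = g i" for g :: "_ \<Rightarrow> real"
  proof -
    have "(MIN j\<in>J. g j) \<in> g ` J"
      using assms(1,2) by (intro Min_in) simp_all
    then show ?thesis
      by (rule imageE) (rule bexI)
  qed
  have lower: "(MIN j\<in>J. g j) \<le> g i" if "i \<in> J" for g :: "_ \<Rightarrow> real" and i
    using that assms(1) by simp
  have F_range: "(MIN j\<in>J. F j) \<in> {0<..1}"
    using attained[of F] F by auto
  have range: "(\<lambda>x. MIN j\<in>J. f j x) \<in> {0<..<1} \<rightarrow> {0<..1}"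
  proof
    fix x :: real assume "x \<in> {0<..<1}"
    moreover obtain i where "i \<in> J" "(MIN j\<in>J. f j x) = f i x"
      using attained[of "\<lambda>j. f j x"] by blast
    ultimately show "(MIN j\<in>J. f j x) \<in> {0<..1}"
      using good[of i] unfolding one_good_def by auto
  qed
  have below: "(MIN j\<in>J. f j x) = (MIN j\<in>J. F j)"
    if "x \<in> {0<..<1}" "x < (MIN j\<in>J. F j)" for x
  proof -
    have "f j x = F j" if j: "j \<in> J" for j
    proof -
      have "x < F j"
        using \<open>x < (MIN j\<in>J. F j)\<close> lower[OF j, of F] by linarith
      then show ?thesis
        using F \<open>x \<in> {0<..<1}\<close> j by blast
    qed
    then show ?thesis by simp
  qed
  have above: "(MIN j\<in>J. f j x) \<le> x"
    if x: "x \<in> {0<..<1}" "x \<ge> (MIN j\<in>J. F j)" for x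
  proof -
    obtain i where i: "i \<in> J" "(MIN j\<in>J. F j) = F i"
      using attained[of F] by blast
    then have "f i x \<le> x"
      using F x by auto
    then show ?thesis
      using lower[OF i(1), of "\<lambda>j. f j x"] by linarith
  qed
  show ?thesis
    unfolding one_good_def
    by (intro conjI bexI[of _ "MIN j\<in>J. F j"] ballI impI range F_range below above)
qed

lemma restrict_in_assignments:
  assumes "X \<in> assignments I" "J \<subseteq> I"
  shows "restrict X J \<in> assignments J"
  using assms unfolding assignments_def restrict_PiE_iff by (blast dest: PiE_mem)

text \<open>Supplies the hash function that \<open>tcf_at\<close> needs in order to denote a genuine
  threshold at a partial assignment.\<close>

lemma assignment_extends:
  assumes "X \<in> assignments J" "J \<subseteq> I"
  obtains h where "h \<in> assignments I" "restrict h J = X"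
proof
  \<comment> \<open>The filler \<open>1 / 2\<close> is an arbitrary point of (0,1); the outer
    \<open>restrict\<close> makes \<open>h\<close> extensional on \<open>I\<close>.\<close>
  define h where "h = restrict (\<lambda>i. if i \<in> J then X i else 1 / 2) I"
  show "h \<in> assignments I"
    using assms unfolding h_def assignments_def by (auto simp: PiE_iff)
  show "restrict h J = X"
    using assms unfolding h_def assignments_def
    by (auto simp: restrict_def PiE_iff extensional_def fun_eq_iff)
qed

lemma is_tcf_range:
  assumes "is_tcf n T" "stream n A" "h \<in> hash_functions n"
  shows "T k A h \<in> {0<..1}"
  using assms unfolding is_tcf_def by blast

lemma is_tcf_cong:
  assumes "is_tcf n T" "stream n A" "h \<in> hash_functions n" "h' \<in> hash_functions n"
    and "restrict h (set A) = restrict h' (set A)"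
  shows "T k A h = T k A h'"
  using assms unfolding is_tcf_def by blast

text \<open>The definite description is well defined because a TCF sees \<open>h\<close> only
  through its restriction to the stream; \<open>h\<close> itself is the witness.\<close>

lemma tcf_at_restrict:
  assumes "is_tcf n T" "stream n A" "h \<in> hash_functions n"
  shows "tcf_at n T k A (restrict h (set A)) = T k A h"
  unfolding tcf_at_def
proof (rule the_equality)
  show "\<exists>h'\<in>hash_functions n. restrict h' (set A) = restrict h (set A) \<and> T k A h' = T k A h"
    using assms(3) by blast
next
  fix \<theta>
  assume "\<exists>h'\<in>hash_functions n. restrict h' (set A) = restrict h (set A) \<and> T k A h' = \<theta>"
  then show "\<theta> = T k A h"
    using is_tcf_cong[OF assms(1,2) _ assms(3)] by (elim bexE conjE) (rule trans[OF sym])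
qed

lemma tcf_at_range:
  assumes "is_tcf n T" "stream n A" "X \<in> assignments (set A)"
  shows "tcf_at n T k A X \<in> {0<..1}"
proof -
  obtain h where h: "h \<in> hash_functions n" "restrict h (set A) = X"
    using assignment_extends[OF assms(3)] assms(2) unfolding stream_def by blast
  then have "tcf_at n T k A X = T k A h"
    using tcf_at_restrict[OF assms(1,2) h(1), of k] by simp
  then show ?thesis
    using is_tcf_range[OF assms(1,2) h(1), of k] by simp
qed

text \<open>Transfers 1-Goodness from the stream's own identifiers to those of the union: fixing
  hash values on \<open>U - {l}\<close> fixes them on \<open>set A - {l}\<close>, so the map is a
  projection of \<open>T\<close> itself or a constant.\<close>

lemma one_good_projection_restrict:
  assumes T: "is_tcf n T" "tcf_one_good n k T" and A: "stream n A" "set A \<subseteq> U"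
    and X: "X \<in> assignments (U - {l})"
  shows "one_good (\<lambda>x. tcf_at n T k A (restrict (X(l := x)) (set A)))"
proof (cases "l \<in> set A")
  case True
  have "restrict X (set A - {l}) \<in> assignments (set A - {l})"
    using A(2) by (intro restrict_in_assignments[OF X]) auto
  then have "one_good (\<lambda>x. tcf_at n T k A ((restrict X (set A - {l}))(l := x)))"
    using T(2) A(1) True unfolding tcf_one_good_def projections_one_good_def by blast
  \<comment> \<open>As \<open>l\<close> occurs in \<open>A\<close>, restricting keeps the updated
    value, so update and restriction can be exchanged.\<close>
  moreover have "restrict (X(l := x)) (set A) = (restrict X (set A - {l}))(l := x)" for x
    using True by (auto simp: restrict_def)
  ultimately show ?thesis by simp
next
  case False
  have "restrict X (set A) \<in> assignments (set A)"
    using A(2) False by (intro restrict_in_assignments[OF X]) auto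
  then have "one_good (\<lambda>x. tcf_at n T k A (restrict X (set A)))"
    by (intro one_good_const tcf_at_range[OF T(1) A(1)])
  moreover have "restrict (X(l := x)) (set A) = restrict X (set A)" for x
    using False by (auto simp: restrict_def)
  ultimately show ?thesis by simp
qed

theorem theorem9:
  fixes n m k :: nat
    and A :: "nat \<Rightarrow> nat list"
    and T :: "nat \<Rightarrow> tcf"
    and U :: "nat set"
  assumes "m \<ge> 1"
    and "\<And>j. j \<in> {1..m} \<Longrightarrow> stream n (A j)"
    and "\<And>j. j \<in> {1..m} \<Longrightarrow> is_tcf n (T j)"
    and "\<And>j. j \<in> {1..m} \<Longrightarrow> tcf_one_good n k (T j)"
    and "U = (\<Union>j\<in>{1..m}. set (A j))"
  shows "projections_one_good U (union_threshold n m T k A) \<and>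
    (\<forall>h\<in>hash_functions n.
       fst (theta_union m (\<lambda>j. samp (T j) k (A j) h)) = union_threshold n m T k A (restrict h U))"
proof (intro conjI ballI)
  show "projections_one_good U (union_threshold n m T k A)"
    unfolding projections_one_good_def union_threshold_def
  proof (intro ballI one_good_Min)
    fix l X j
    assume "X \<in> assignments (U - {l})" and j: "j \<in> {1..m}"
    then show "one_good (\<lambda>x. tcf_at n (T j) k (A j) (restrict (X(l := x)) (set (A j))))"
      using assms(5) by (intro one_good_projection_restrict assms(2-4)) auto
  \<comment> \<open>What remains is that \<open>{1..m}\<close> is finite and nonempty, the latter by
    \<open>m \<ge> 1\<close>.\<close>
  qed (use assms(1) in auto)
next
  fix h assume h: "h \<in> hash_functions n"
  have "tcf_at n (T j) k (A j) (restrict (restrict h U) (set (A j))) = T j k (A j) h"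
    if j: "j \<in> {1..m}" for j
  proof -
    \<comment> \<open>This collapses the double restriction of \<open>h\<close> to
      \<open>restrict h (set (A j))\<close>, so the two minima agree term by term.\<close>
    have "U \<inter> set (A j) = set (A j)"
      using assms(5) j by auto
    then show ?thesis
      by (simp add: tcf_at_restrict[OF assms(3)[OF j] assms(2)[OF j] h, of k])
  qed
  then show "fst (theta_union m (\<lambda>j. samp (T j) k (A j) h))
      = union_threshold n m T k A (restrict h U)"
    by (simp add: theta_union_def samp_def union_threshold_def Let_def)
qed

end
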